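(* Let $G$ be an unweighted simple graph on $n$ vertices diagonalisable by a matrix $H$ of order $n$ that is either a normalised (real) Hadamard matrix or a dephased Turyn Hadamard matrix. Let $\mathbf{h}_1=\mathbf{1},\mathbf{h}_2,\dots,\mathbf{h}_n$ be the columns of $H$, with $L(G)\mathbf{h}_j=\lambda_j\mathbf{h}_j$ for $j=1,\dots,n$, and let $d$ be the common degree of the vertices of $G$. Then for each $k>1$, $G$ has an equitable partition into two cells, each having exactly $\frac n2$ vertices, with quotient matrix $$\begin{bmatrix} d-\frac{\lambda_k}{2} & \frac{\lambda_k}{2}\\ \frac{\lambda_k}{2} & d-\frac{\lambda_k}{2}\end{bmatrix}.$$ Moreover, the eigenvalues of $L(G)$ are even integers.
   Context: A complex Hadamard matrix of order $n$ is an $n\times n$ complex matrix $H$ whose entries all have modulus one and which satisfies $HH^*=nI$. It is a (real) Hadamard matrix if all entries are $\pm1$, and a Turyn Hadamard matrix if all entries lie in $\{1,-1,\mathrm i,-\mathrm i\}$. Normalised (real case) or dephased (complex case) means that the first row and first column are all-ones vectors. $L(G)=D(G)-A(G)$ is the Laplacian matrix. $G$ is diagonalisable by $H$ if every column of $H$ is an eigenvector of $L(G)$; such a graph is necessarily regular. $\mathbf 1$ is the all-ones vector. A partition $V(G)=V_1\cup\dots\cup V_m$ is equitable if for all $i,j$ there is a constant $v_{i,j}$ such that every vertex in $V_i$ has exactly $v_{i,j}$ neighbours in $V_j$; its quotient matrix is $[v_{i,j}]$. *)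

theory Defs
  imports
    Complex_Main
    "HOL-Library.Disjoint_Sets"
    "Graph_Theory.Pair_Digraph"
    "Jordan_Normal_Form.Char_Poly"
    "Jordan_Normal_Form.Schur_Decomposition"
begin

text \<open>A finite simple graph is a \<^locale>\<open>pair_graph\<close>: an undirected edge is a pair of opposite
  arcs, so the degree of a vertex is its \<^const>\<open>out_degree\<close>. The matrices below are intended for
  graphs with vertex set \<open>{0..<n}\<close>; vertex \<open>i\<close> labels row and column \<open>i\<close>.
  Rows and columns of matrices are numbered from 0.\<close>

definition degree_matrix :: "nat pair_pre_digraph \<Rightarrow> complex mat" where
  "degree_matrix G = (let n = card (pverts G) in
     mat n n (\<lambda>(i, j). if i = j then of_nat (out_degree (with_proj G) i) else 0))"

definition adjacency_matrix :: "nat pair_pre_digraph \<Rightarrow> complex mat" where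
  "adjacency_matrix G = (let n = card (pverts G) in
     mat n n (\<lambda>(i, j). if (i, j) \<in> parcs G then 1 else 0))"

definition laplacian :: "nat pair_pre_digraph \<Rightarrow> complex mat" where
  "laplacian G = degree_matrix G - adjacency_matrix G"

definition complex_hadamard :: "nat \<Rightarrow> complex mat \<Rightarrow> bool" where
  "complex_hadamard n H \<longleftrightarrow>
     H \<in> carrier_mat n n \<and>
     (\<forall>i<n. \<forall>j<n. cmod (H $$ (i, j)) = 1) \<and>
     H * mat_adjoint H = of_nat n \<cdot>\<^sub>m 1\<^sub>m n"

definition real_hadamard :: "nat \<Rightarrow> complex mat \<Rightarrow> bool" where
  "real_hadamard n H \<longleftrightarrow>
     complex_hadamard n H \<and> (\<forall>i<n. \<forall>j<n. H $$ (i, j) \<in> {1, -1})"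

definition turyn_hadamard :: "nat \<Rightarrow> complex mat \<Rightarrow> bool" where
  "turyn_hadamard n H \<longleftrightarrow>
     complex_hadamard n H \<and> (\<forall>i<n. \<forall>j<n. H $$ (i, j) \<in> {1, -1, \<i>, -\<i>})"

text \<open>Also called normalised when the matrix is real.\<close>

definition dephased :: "nat \<Rightarrow> complex mat \<Rightarrow> bool" where
  "dephased n H \<longleftrightarrow> (\<forall>i<n. H $$ (0, i) = 1 \<and> H $$ (i, 0) = 1)"

definition diagonalisable_by :: "nat pair_pre_digraph \<Rightarrow> complex mat \<Rightarrow> bool" where
  "diagonalisable_by G H \<longleftrightarrow>
     (\<forall>j<dim_col H. \<exists>\<mu>. eigenvector (laplacian G) (col H j) \<mu>)"

definition neighbours_in :: "'a pair_pre_digraph \<Rightarrow> 'a \<Rightarrow> 'a set \<Rightarrow> 'a set" where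
  "neighbours_in G u W = {w \<in> W. (u, w) \<in> parcs G}"

text \<open>The cells are listed, since the quotient matrix depends on their order.\<close>

definition equitable_partition :: "'a pair_pre_digraph \<Rightarrow> 'a set list \<Rightarrow> bool" where
  "equitable_partition G Vs \<longleftrightarrow>
     distinct Vs \<and> partition_on (pverts G) (set Vs) \<and>
     (\<forall>i<length Vs. \<forall>j<length Vs.
        \<exists>c. \<forall>u\<in>Vs ! i. card (neighbours_in G u (Vs ! j)) = c)"

text \<open>For an equitable partition the number described by \<open>THE\<close> exists, and it is unique because
  cells are nonempty.\<close>

definition quotient_matrix :: "'a pair_pre_digraph \<Rightarrow> 'a set list \<Rightarrow> complex mat" where
  "quotient_matrix G Vs = mat (length Vs) (length Vs)
     (\<lambda>(i, j). of_nat (THE c. \<forall>u\<in>Vs ! i. card (neighbours_in G u (Vs ! j)) = c))"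

end

theory Submission
  imports Defs
begin

text \<open>If \<open>h\<close> has entries in \<open>{1, -1, \<i>, -\<i>}\<close>, then \<open>Re h + Im h\<close> has entries
  \<open>\<plusminus>1\<close>. Since the Laplacian and its eigenvalues are real, this vector is an eigenvector for the same
  eigenvalue as \<open>h\<close>, and it sums to zero if \<open>h\<close> is orthogonal to the all-ones vector. Its two level
  sets are the cells: the eigenvalue equation at a vertex says that twice the number of
  neighbours in the other cell is the eigenvalue. Regularity holds because \<open>n L = H \<Lambda> H\<^sup>*\<close>
  and the entries of \<open>H\<close> have modulus one, so that all diagonal entries of \<open>n L\<close> equal
  the trace of \<open>\<Lambda>\<close>.\<close>

section \<open>Hermitian matrices\<close>

lemma cscalar_prod_hermitian:
  fixes A :: "complex mat"
  assumes A: "A \<in> carrier_mat n n"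
    and herm: "\<And>i j. i < n \<Longrightarrow> j < n \<Longrightarrow> A $$ (j, i) = cnj (A $$ (i, j))"
    and x: "x \<in> carrier_vec n" and y: "y \<in> carrier_vec n"
  shows "(A *\<^sub>v x) \<bullet>c y = x \<bullet>c (A *\<^sub>v y)"
proof -
  have "(A *\<^sub>v x) \<bullet>c y = (\<Sum>i<n. \<Sum>j<n. A $$ (i, j) * x $ j * cnj (y $ i))"
    using A x y by (simp add: scalar_prod_def sum_distrib_right atLeast0LessThan)
  also have "\<dots> = (\<Sum>j<n. \<Sum>i<n. A $$ (i, j) * x $ j * cnj (y $ i))"
    by (rule sum.swap)
  also have "\<dots> = (\<Sum>j<n. \<Sum>i<n. x $ j * (cnj (A $$ (j, i)) * cnj (y $ i)))"
    by (intro sum.cong refl) (subst herm, simp_all)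
  also have "\<dots> = x \<bullet>c (A *\<^sub>v y)"
    using A x y by (simp add: scalar_prod_def sum_distrib_left atLeast0LessThan)
  finally show ?thesis .
qed

text \<open>Moving \<open>A\<close> across the inner product evaluates it with either eigenvalue.
  The identity serves twice: with \<open>y = x\<close> it makes eigenvalues real, and with
  \<open>y\<close> a column of a Hadamard matrix it identifies an arbitrary eigenvalue of the
  Laplacian with one belonging to a column.\<close>

lemma hermitian_eigenvectors_cscalar_prod:
  fixes A :: "complex mat"
  assumes A: "A \<in> carrier_mat n n"
    and herm: "\<And>i j. i < n \<Longrightarrow> j < n \<Longrightarrow> A $$ (j, i) = cnj (A $$ (i, j))"
    and x: "eigenvector A x \<mu>" and y: "eigenvector A y \<nu>"
  shows "\<mu> * (x \<bullet>c y) = cnj \<nu> * (x \<bullet>c y)"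
proof -
  have xc: "x \<in> carrier_vec n" and yc: "y \<in> carrier_vec n"
    using x y A by (auto simp: eigenvector_def)
  have "\<mu> * (x \<bullet>c y) = (A *\<^sub>v x) \<bullet>c y"
    using x xc yc by (simp add: eigenvector_def)
  also have "\<dots> = x \<bullet>c (A *\<^sub>v y)"
    using A herm xc yc by (rule cscalar_prod_hermitian)
  also have "\<dots> = cnj \<nu> * (x \<bullet>c y)"
    using y xc yc by (simp add: eigenvector_def conjugate_smult_vec)
  finally show ?thesis .
qed

lemma hermitian_eigenvalue_real:
  fixes A :: "complex mat"
  assumes A: "A \<in> carrier_mat n n"
    and herm: "\<And>i j. i < n \<Longrightarrow> j < n \<Longrightarrow> A $$ (j, i) = cnj (A $$ (i, j))"
    and x: "eigenvector A x \<mu>"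
  shows "cnj \<mu> = \<mu>"
proof -
  have "x \<in> carrier_vec n" "x \<noteq> 0\<^sub>v n"
    using x A by (auto simp: eigenvector_def)
  then have "x \<bullet>c x \<noteq> 0"
    using conjugate_square_eq_0_vec by blast
  with hermitian_eigenvectors_cscalar_prod[OF A herm x x] show ?thesis
    by simp
qed

section \<open>Complex Hadamard matrices\<close>

lemma complex_hadamard_rows:
  assumes "complex_hadamard n H" "i < n" "j < n"
  shows "(\<Sum>k<n. H $$ (i, k) * cnj (H $$ (j, k))) = (if i = j then of_nat n else 0)"
proof -
  have H: "H \<in> carrier_mat n n" and eq: "H * mat_adjoint H = of_nat n \<cdot>\<^sub>m 1\<^sub>m n"
    using assms by (auto simp: complex_hadamard_def)
  have "(H * mat_adjoint H) $$ (i, j) = (\<Sum>k<n. H $$ (i, k) * cnj (H $$ (j, k)))"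
    using H assms by (simp add: mat_adjoint_def scalar_prod_def mat_of_rows_index atLeast0LessThan)
  then show ?thesis
    using eq assms by (auto split: if_splits)
qed

text \<open>Row orthogonality says that the adjoint of \<open>H\<close> divided by \<open>n\<close>
  is a right inverse of \<open>H\<close>. For square matrices it is then also a left inverse, which
  is column orthogonality.\<close>

lemma complex_hadamard_columns:
  assumes H: "complex_hadamard n H" and kl: "k < n" "l < n"
  shows "(\<Sum>i<n. cnj (H $$ (i, k)) * H $$ (i, l)) = (if k = l then of_nat n else 0)"
proof -
  define B where "B = mat n n (\<lambda>(k, i). cnj (H $$ (i, k)) / of_nat n)"
  have Hc: "H \<in> carrier_mat n n"
    using H by (simp add: complex_hadamard_def)
  have Bc: "B \<in> carrier_mat n n"
    by (simp add: B_def)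
  have "H * B = 1\<^sub>m n"
  proof (rule eq_matI)
    fix i j assume "i < dim_row (1\<^sub>m n :: complex mat)" "j < dim_col (1\<^sub>m n :: complex mat)"
    then have ij: "i < n" "j < n" by simp_all
    have "(H * B) $$ (i, j) = (\<Sum>k<n. H $$ (i, k) * cnj (H $$ (j, k))) / of_nat n"
      using Hc ij by (simp add: B_def scalar_prod_def atLeast0LessThan sum_divide_distrib)
    then show "(H * B) $$ (i, j) = 1\<^sub>m n $$ (i, j)"
      using complex_hadamard_rows[OF H ij] ij by auto
  qed (use Hc in \<open>auto simp: B_def\<close>)
  then have "B * H = 1\<^sub>m n"
    by (rule mat_mult_left_right_inverse[OF Hc Bc])
  moreover have "(B * H) $$ (k, l) = (\<Sum>i<n. cnj (H $$ (i, k)) * H $$ (i, l)) / of_nat n"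
    using Hc kl by (simp add: B_def scalar_prod_def atLeast0LessThan sum_divide_distrib)
  ultimately show ?thesis
    using kl by (auto simp: field_simps split: if_splits)
qed

text \<open>Row orthogonality gives the expansion of \<open>n\<close> times \<open>v\<close> as the
  sum of the columns \<open>col H k\<close> with coefficients \<open>v \<bullet>c col H k\<close>.
  Hence every nonzero vector has a nonzero product with some column.\<close>

lemma complex_hadamard_orthogonal_all:
  assumes H: "complex_hadamard n H" and v: "v \<in> carrier_vec n"
    and orth: "\<And>k. k < n \<Longrightarrow> v \<bullet>c col H k = 0"
  shows "v = 0\<^sub>v n"
proof (rule eq_vecI)
  fix i assume "i < dim_vec (0\<^sub>v n :: complex vec)"
  then have i: "i < n" by simp
  have Hc: "H \<in> carrier_mat n n"
    using H by (simp add: complex_hadamard_def)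
  have "v $ i * of_nat n = (\<Sum>j<n. v $ j * (if i = j then of_nat n else 0))"
    using i by (simp add: if_distrib sum.delta cong: if_cong)
  also have "\<dots> = (\<Sum>j<n. \<Sum>k<n. v $ j * (H $$ (i, k) * cnj (H $$ (j, k))))"
    using complex_hadamard_rows[OF H i] by (simp flip: sum_distrib_left)
  also have "\<dots> = (\<Sum>k<n. \<Sum>j<n. v $ j * (H $$ (i, k) * cnj (H $$ (j, k))))"
    by (rule sum.swap)
  also have "\<dots> = (\<Sum>k<n. H $$ (i, k) * (v \<bullet>c col H k))"
    using Hc v by (simp add: scalar_prod_def sum_distrib_left atLeast0LessThan mult_ac)
  also have "\<dots> = 0"
    using orth by simp
  finally show "v $ i = 0\<^sub>v n $ i"
    using i by simp
qed (use v in simp)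

section \<open>The Laplacian\<close>

lemma (in pair_fin_digraph) finite_neighbours: "finite {w. (u, w) \<in> parcs G}"
  by (rule finite_subset[OF _ pair_finite_verts]) (auto dest: in_arcsD2)

lemma out_degree_with_proj: "out_degree (with_proj G) u = card {w. (u, w) \<in> parcs G}"
proof -
  have "out_arcs (with_proj G) u = Pair u ` {w. (u, w) \<in> parcs G}"
    by (auto simp: out_arcs_def)
  then show ?thesis
    by (simp add: out_degree_def card_image inj_on_def)
qed

lemma laplacian_carrier:
  assumes "pverts G = {0..<n}"
  shows "laplacian G \<in> carrier_mat n n"
  using assms by (intro carrier_matI) (simp_all add: laplacian_def degree_matrix_def adjacency_matrix_def)

lemma laplacian_index:
  assumes "pverts G = {0..<n}" "i < n" "j < n"
  shows "laplacian G $$ (i, j) =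
    (if i = j then of_nat (out_degree (with_proj G) i) else 0) - (if (i, j) \<in> parcs G then 1 else 0)"
  using assms by (simp add: laplacian_def degree_matrix_def adjacency_matrix_def)

lemma laplacian_hermitian:
  assumes G: "pair_graph G" and V: "pverts G = {0..<n}" and ij: "i < n" "j < n"
  shows "laplacian G $$ (j, i) = cnj (laplacian G $$ (i, j))"
proof -
  interpret pair_graph G by fact
  have "(j, i) \<in> parcs G \<longleftrightarrow> (i, j) \<in> parcs G"
    by (blast intro: arcs_symmetric)
  then show ?thesis
    using ij by (simp add: laplacian_index[OF V])
qed

lemma laplacian_mult_vec_index:
  assumes G: "pair_graph G" and V: "pverts G = {0..<n}" and x: "x \<in> carrier_vec n" and i: "i < n"
  shows "(laplacian G *\<^sub>v x) $ i =
    of_nat (out_degree (with_proj G) i) * x $ i - (\<Sum>j | (i, j) \<in> parcs G. x $ j)"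
proof -
  interpret pair_graph G by fact
  have nb: "{j. j < n \<and> (i, j) \<in> parcs G} = {j. (i, j) \<in> parcs G}"
    using V by (auto dest: in_arcsD2)
  have "(laplacian G *\<^sub>v x) $ i = (\<Sum>j<n. laplacian G $$ (i, j) * x $ j)"
    using laplacian_carrier[OF V] x i by (simp add: scalar_prod_def atLeast0LessThan)
  also have "\<dots> = (\<Sum>j<n. (if i = j then of_nat (out_degree (with_proj G) i) * x $ j else 0)
      - (if (i, j) \<in> parcs G then x $ j else 0))"
    using i by (intro sum.cong refl) (simp add: laplacian_index[OF V] left_diff_distrib)
  also have "\<dots> = of_nat (out_degree (with_proj G) i) * x $ i - (\<Sum>j | (i, j) \<in> parcs G. x $ j)"
    using i by (simp add: sum_subtractf nb flip: sum.inter_filter)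
  finally show ?thesis .
qed

text \<open>The entry \<open>(i, i)\<close> of the Laplacian times \<open>H\<close> times the
  adjoint of \<open>H\<close> is computed in two ways. The right-hand side does not mention
  \<open>i\<close>, so the lemma yields regularity.\<close>

lemma laplacian_hadamard_trace:
  assumes H: "complex_hadamard n H" and V: "pverts G = {0..<n}" and G: "pair_graph G"
    and ev: "\<And>k. k < n \<Longrightarrow> laplacian G *\<^sub>v col H k = ev k \<cdot>\<^sub>v col H k"
    and i: "i < n"
  shows "of_nat n * of_nat (out_degree (with_proj G) i) = (\<Sum>k<n. ev k)"
proof -
  interpret pair_graph G by fact
  let ?L = "laplacian G"
  have Hc: "H \<in> carrier_mat n n" and mod1: "\<And>k. k < n \<Longrightarrow> cmod (H $$ (i, k)) = 1"
    using H i by (auto simp: complex_hadamard_def)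
  have unit: "H $$ (i, k) * cnj (H $$ (i, k)) = 1" if "k < n" for k
    using mod1[OF that] by (simp flip: complex_norm_square)
  have row: "(\<Sum>j<n. ?L $$ (i, j) * H $$ (j, k)) = ev k * H $$ (i, k)" if "k < n" for k
  proof -
    have "(?L *\<^sub>v col H k) $ i = (\<Sum>j<n. ?L $$ (i, j) * H $$ (j, k))"
      using laplacian_carrier[OF V] Hc i that by (simp add: scalar_prod_def atLeast0LessThan)
    then show ?thesis
      using ev[OF that] Hc i that by simp
  qed
  \<comment> \<open>Without loops, the diagonal entry of the Laplacian is the degree itself.\<close>
  have "of_nat n * of_nat (out_degree (with_proj G) i) = ?L $$ (i, i) * of_nat n"
    using i no_loops' by (auto simp: laplacian_index[OF V])
  \<comment> \<open>The factor \<open>n\<close> is spread over the row as a Kronecker delta, so that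
    row orthogonality can expand it in the next step.\<close>
  also have "\<dots> = (\<Sum>j<n. ?L $$ (i, j) * (if j = i then of_nat n else 0))"
    using i by (simp add: if_distrib sum.delta cong: if_cong)
  also have "\<dots> = (\<Sum>j<n. \<Sum>k<n. ?L $$ (i, j) * (H $$ (j, k) * cnj (H $$ (i, k))))"
    using complex_hadamard_rows[OF H _ i] by (simp flip: sum_distrib_left)
  also have "\<dots> = (\<Sum>k<n. \<Sum>j<n. ?L $$ (i, j) * (H $$ (j, k) * cnj (H $$ (i, k))))"
    by (rule sum.swap)
  also have "\<dots> = (\<Sum>k<n. (\<Sum>j<n. ?L $$ (i, j) * H $$ (j, k)) * cnj (H $$ (i, k)))"
    by (simp add: sum_distrib_right mult.assoc)
  also have "\<dots> = (\<Sum>k<n. ev k)"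
    using row unit by (simp add: mult.assoc)
  finally show ?thesis .
qed

section \<open>Sign vectors and equitable bipartitions\<close>

text \<open>Let \<open>a\<close> neighbours of \<open>u\<close> share its sign and \<open>b\<close>
  have the other one. Dividing the eigenvalue equation by \<open>x u\<close> gives
  \<open>d - (a - b) = r\<close>, and \<open>d = a + b\<close>; so \<open>b = r / 2\<close> and
  \<open>a = d - r / 2\<close>.\<close>

lemma sign_eigenvector_neighbours:
  fixes x :: "'a \<Rightarrow> real" and r s :: real
  assumes G: "pair_graph G"
    and x: "\<And>v. v \<in> pverts G \<Longrightarrow> x v \<in> {1, -1}"
    and deg: "card {w. (u, w) \<in> parcs G} = d"
    and eig: "real d * x u - (\<Sum>w | (u, w) \<in> parcs G. x w) = r * x u"
    and s: "s \<in> {1, -1}" and u: "x u \<in> {1, -1}"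
  shows "real (card (neighbours_in G u {v \<in> pverts G. x v = s})) =
    (if s = x u then real d - r / 2 else r / 2)"
proof -
  interpret pair_graph G by fact
  define N where "N t = neighbours_in G u {v \<in> pverts G. x v = t}" for t :: real
  have fin: "finite (N t)" for t
    by (rule finite_subset[OF _ finite_neighbours[of u]]) (auto simp: N_def neighbours_in_def)
  have un: "{w. (u, w) \<in> parcs G} = N 1 \<union> N (-1)"
    using x by (auto simp: N_def neighbours_in_def dest: in_arcsD2)
  have dj: "N 1 \<inter> N (-1) = {}"
    by (auto simp: N_def neighbours_in_def)
  have c: "d = card (N 1) + card (N (-1))"
    using deg un dj fin by (simp add: card_Un_disjoint)
  have s1: "(\<Sum>w\<in>N t. x w) = t * real (card (N t))" for t
    by (simp add: N_def neighbours_in_def)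
  have "(\<Sum>w | (u, w) \<in> parcs G. x w) = real (card (N 1)) - real (card (N (-1)))"
    unfolding un using dj fin by (simp add: sum.union_disjoint s1)
  then have eq: "real d * x u - (real (card (N 1)) - real (card (N (-1)))) = r * x u"
    using eig by simp
  have d: "real d = real (card (N 1)) + real (card (N (-1)))"
    using c by simp
  consider "x u = 1" "s = 1" | "x u = 1" "s = -1" | "x u = -1" "s = 1" | "x u = -1" "s = -1"
    using s u by blast
  then have "real (card (N s)) = (if s = x u then real d - r / 2 else r / 2)"
    by cases (use eq d in simp_all)
  then show ?thesis
    by (simp add: N_def)
qed

text \<open>The sum of a sign vector is the difference of the sizes of its level sets, so a zero sum
  makes them equal.\<close>

lemma sign_vector_level_sets:
  fixes x :: "'a \<Rightarrow> real"
  assumes fin: "finite V" and x: "\<And>v. v \<in> V \<Longrightarrow> x v \<in> {1, -1}" and sum0: "(\<Sum>v\<in>V. x v) = 0"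
    and s: "s \<in> {1, -1}"
  shows "real (card {v \<in> V. x v = s}) = real (card V) / 2"
proof -
  define P where "P t = {v \<in> V. x v = t}" for t :: real
  have un: "V = P 1 \<union> P (-1)" and dj: "P 1 \<inter> P (-1) = {}"
    using x by (auto simp: P_def)
  have finP: "finite (P t)" for t
    using fin by (simp add: P_def)
  have sumP: "sum x (P t) = t * real (card (P t))" for t
    by (simp add: P_def)
  have "sum x V = real (card (P 1)) - real (card (P (-1)))"
    by (subst un, subst sum.union_disjoint) (use finP dj in \<open>auto simp: sumP\<close>)
  moreover have "card V = card (P 1) + card (P (-1))"
    by (subst un) (use finP dj in \<open>simp add: card_Un_disjoint\<close>)
  ultimately have "real (card (P s)) = real (card V) / 2"
    using s sum0 by auto
  then show ?thesis
    by (simp add: P_def)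
qed

text \<open>Each cell contains a vertex, and its neighbour counts leave only one candidate for the
  \<open>THE\<close> in \<open>quotient_matrix\<close>.\<close>

lemma quotient_matrix_eqI:
  assumes "\<And>W. W \<in> set Vs \<Longrightarrow> W \<noteq> {}"
    and "\<And>i j u. i < length Vs \<Longrightarrow> j < length Vs \<Longrightarrow> u \<in> Vs ! i \<Longrightarrow>
      card (neighbours_in G u (Vs ! j)) = c i j"
  shows "quotient_matrix G Vs = mat (length Vs) (length Vs) (\<lambda>(i, j). of_nat (c i j))"
proof (rule eq_matI)
  fix i j assume "i < dim_row (mat (length Vs) (length Vs) (\<lambda>(i, j). of_nat (c i j) :: complex))"
    "j < dim_col (mat (length Vs) (length Vs) (\<lambda>(i, j). of_nat (c i j) :: complex))"
  then have ij: "i < length Vs" "j < length Vs" by simp_all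
  obtain u where u: "u \<in> Vs ! i"
    using assms(1)[of "Vs ! i"] ij by auto
  have "(THE m. \<forall>u\<in>Vs ! i. card (neighbours_in G u (Vs ! j)) = m) = c i j"
    by (rule the_equality) (use u assms(2)[OF ij] in auto)
  then show "quotient_matrix G Vs $$ (i, j) =
      mat (length Vs) (length Vs) (\<lambda>(i, j). of_nat (c i j)) $$ (i, j)"
    using ij by (simp add: quotient_matrix_def)
qed (simp_all add: quotient_matrix_def)

text \<open>The cells are the level sets of \<open>x\<close>, the positive one first. The number
  \<open>m\<close> counts the neighbours that a vertex has in the opposite cell; it is recorded
  because \<open>r = 2 * real m\<close> later shows that the eigenvalue is even.\<close>

lemma sign_eigenvector_equitable_partition:
  fixes x :: "'a \<Rightarrow> real" and r :: real
  assumes G: "pair_graph G" and ne: "pverts G \<noteq> {}"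
    and x: "\<And>v. v \<in> pverts G \<Longrightarrow> x v \<in> {1, -1}"
    and sum0: "(\<Sum>v\<in>pverts G. x v) = 0"
    and deg: "\<And>u. u \<in> pverts G \<Longrightarrow> card {w. (u, w) \<in> parcs G} = d"
    and eig: "\<And>u. u \<in> pverts G \<Longrightarrow>
      real d * x u - (\<Sum>w | (u, w) \<in> parcs G. x w) = r * x u"
  obtains V1 V2 m where
    "equitable_partition G [V1, V2]"
    "real (card V1) = real (card (pverts G)) / 2" "real (card V2) = real (card (pverts G)) / 2"
    "quotient_matrix G [V1, V2] = mat_of_rows_list 2
      [[of_nat d - of_real r / 2, of_real r / 2], [of_real r / 2, of_nat d - of_real r / 2]]"
    "r = 2 * real m"
proof -
  interpret pair_graph G by fact
  define V where "V s = {v \<in> pverts G. x v = s}" for s :: real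
  \<comment> \<open>Quotient matrices need natural numbers, while \<open>d - r / 2\<close> and
    \<open>r / 2\<close> are real. Rounding makes \<open>c\<close> well defined at once; the next
    facts show that it changes nothing, these reals being actual neighbour counts.\<close>
  define c where "c s t = (if s = t then nat \<lfloor>real d - r / 2\<rfloor> else nat \<lfloor>r / 2\<rfloor>)" for s t :: real
  have cardV: "real (card (V s)) = real (card (pverts G)) / 2" if "s \<in> {1, -1}" for s
    unfolding V_def using pair_finite_verts x sum0 that by (rule sign_vector_level_sets)
  have neV: "V s \<noteq> {}" if "s \<in> {1, -1}" for s
  proof
    assume "V s = {}"
    with cardV[OF that] pair_finite_verts ne show False
      by simp
  qed
  have nb: "real (card (neighbours_in G u (V t))) = (if s = t then real d - r / 2 else r / 2)"
    if "s \<in> {1, -1}" "t \<in> {1, -1}" "u \<in> V s" for s t u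
  proof -
    have u: "u \<in> pverts G" "x u = s"
      using that by (auto simp: V_def)
    show ?thesis
      using sign_eigenvector_neighbours[OF G x deg[OF u(1)] eig[OF u(1)] that(2)] that(1) u(2)
      by (auto simp: V_def)
  qed
  have nbc: "card (neighbours_in G u (V t)) = c s t"
    if "s \<in> {1, -1}" "t \<in> {1, -1}" "u \<in> V s" for s t u
    using nb[OF that] unfolding c_def by (metis floor_of_nat nat_int)
  \<comment> \<open>Going back from \<open>c\<close> to the reals requires a vertex that realises
    the count, hence the nonemptiness of the cell.\<close>
  have cr: "real (c s t) = (if s = t then real d - r / 2 else r / 2)"
    if "s \<in> {1, -1}" "t \<in> {1, -1}" for s t
    using neV[OF that(1)] nb[OF that] nbc[OF that] by (metis all_not_in_conv)
  have crc: "of_nat (c s t) = (if s = t then of_nat d - of_real r / 2 else of_real r / 2 :: complex)"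
    if "s \<in> {1, -1}" "t \<in> {1, -1}" for s t
    using arg_cong[OF cr[OF that], of complex_of_real] by (auto split: if_splits)
  \<comment> \<open>Translates positions in the list of cells into signs.\<close>
  define \<sigma> where "\<sigma> i = (if i = 0 then 1 else -1 :: real)" for i :: nat
  have nth: "[V 1, V (-1)] ! i = V (\<sigma> i)" if "i < 2" for i
    using that by (auto simp: \<sigma>_def less_2_cases_iff)
  have \<sigma>: "\<sigma> i \<in> {1, -1}" for i
    by (simp add: \<sigma>_def)
  have "V 1 \<noteq> V (-1)"
    using neV[of 1] by (auto simp: V_def)
  moreover have "partition_on (pverts G) {V 1, V (-1)}"
    using neV[of 1] neV[of "-1"] x by (auto simp: partition_on_def disjoint_def V_def)
  ultimately have "equitable_partition G [V 1, V (-1)]"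
    unfolding equitable_partition_def
  proof (intro conjI allI impI)
    fix i j assume "i < length [V 1, V (-1)]" "j < length [V 1, V (-1)]"
    then have "[V 1, V (-1)] ! i = V (\<sigma> i)" "[V 1, V (-1)] ! j = V (\<sigma> j)"
      using nth by simp_all
    then show "\<exists>m. \<forall>u\<in>[V 1, V (-1)] ! i. card (neighbours_in G u ([V 1, V (-1)] ! j)) = m"
      using nbc[OF \<sigma> \<sigma>] by (intro exI[of _ "c (\<sigma> i) (\<sigma> j)"]) simp
  qed simp_all
  moreover have "quotient_matrix G [V 1, V (-1)] =
      mat (length [V 1, V (-1)]) (length [V 1, V (-1)]) (\<lambda>(i, j). of_nat (c (\<sigma> i) (\<sigma> j)))"
    by (rule quotient_matrix_eqI) (use neV[of 1] neV[of "-1"] nbc[OF \<sigma> \<sigma>] in \<open>auto simp: nth\<close>)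
  then have "quotient_matrix G [V 1, V (-1)] = mat_of_rows_list 2
      [[of_nat d - of_real r / 2, of_real r / 2], [of_real r / 2, of_nat d - of_real r / 2]]"
    by (auto intro!: eq_matI simp: mat_of_rows_list_def crc \<sigma>_def less_2_cases_iff)
  moreover have "r = 2 * real (c 1 (-1))"
    using cr[of 1 "-1"] by simp
  ultimately show thesis
    using that cardV by blast
qed

section \<open>Graphs diagonalised by a Turyn Hadamard matrix\<close>

text \<open>Adding real and imaginary part sends \<open>1\<close> and \<open>\<i>\<close> to
  \<open>1\<close>, and \<open>-1\<close> and \<open>-\<i>\<close> to \<open>-1\<close>; a real
  column stays as it is. The map is only real-linear, so the eigenvalue is given as
  \<open>of_real r\<close>.\<close>

lemma turyn_column_sign_vector:
  assumes G: "pair_graph G" and V: "pverts G = {0..<n}"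
    and H: "turyn_hadamard n H" and deph: "dephased n H"
    and reg: "\<And>v. v \<in> pverts G \<Longrightarrow> out_degree (with_proj G) v = d"
    and ev: "laplacian G *\<^sub>v col H k = of_real r \<cdot>\<^sub>v col H k"
    and k: "0 < k" "k < n"
  defines "x \<equiv> \<lambda>i. Re (H $$ (i, k)) + Im (H $$ (i, k))"
  shows "\<And>i. i \<in> pverts G \<Longrightarrow> x i \<in> {1, -1}"
    and "(\<Sum>i\<in>pverts G. x i) = 0"
    and "\<And>i. i \<in> pverts G \<Longrightarrow> real d * x i - (\<Sum>j | (i, j) \<in> parcs G. x j) = r * x i"
proof -
  interpret pair_graph G by fact
  have cH: "complex_hadamard n H"
    and ent: "\<And>i. i < n \<Longrightarrow> H $$ (i, k) \<in> {1, -1, \<i>, -\<i>}"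
    using H k by (auto simp: turyn_hadamard_def)
  have Hc: "H \<in> carrier_mat n n"
    using cH by (simp add: complex_hadamard_def)
  show "x i \<in> {1, -1}" if "i \<in> pverts G" for i
    using ent[of i] that V by (auto simp: x_def)
  \<comment> \<open>Column \<open>0\<close> is the all-ones vector, and column \<open>k\<close> is
    orthogonal to it.\<close>
  have "(\<Sum>i<n. H $$ (i, k)) = 0"
    using complex_hadamard_columns[OF cH, of 0 k] deph k by (simp add: dephased_def)
  then have "Re (\<Sum>i<n. H $$ (i, k)) + Im (\<Sum>i<n. H $$ (i, k)) = 0"
    by simp
  then show "(\<Sum>i\<in>pverts G. x i) = 0"
    by (simp add: x_def V sum.distrib atLeast0LessThan)
  show "real d * x i - (\<Sum>j | (i, j) \<in> parcs G. x j) = r * x i" if i: "i \<in> pverts G" for i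
  proof -
    have "i < n"
      using i V by simp
    have "(\<Sum>j | (i, j) \<in> parcs G. col H k $ j) = (\<Sum>j | (i, j) \<in> parcs G. H $$ (j, k))"
      using Hc V k by (intro sum.cong refl) (auto dest!: in_arcsD2)
    then have "of_nat d * H $$ (i, k) - (\<Sum>j | (i, j) \<in> parcs G. H $$ (j, k)) = of_real r * H $$ (i, k)"
      using laplacian_mult_vec_index[OF G V _ \<open>i < n\<close>, of "col H k"] ev Hc \<open>i < n\<close> k reg[OF i]
      by simp
    from arg_cong[OF this, of Re] arg_cong[OF this, of Im] show ?thesis
      by (simp add: x_def sum.distrib algebra_simps)
  qed
qed

text \<open>Lets the theorem treat both kinds of Hadamard matrix as the Turyn case.\<close>

lemma real_hadamard_imp_turyn: "real_hadamard n H \<Longrightarrow> turyn_hadamard n H"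
  by (auto simp: real_hadamard_def turyn_hadamard_def)

theorem corollary2p4:
  fixes n :: nat
    and G :: "nat pair_pre_digraph"
    and H :: "complex mat"
    and ev :: "nat \<Rightarrow> complex"
  assumes "pair_graph G"
    and "pverts G = {0..<n}"
    and "(real_hadamard n H \<and> dephased n H) \<or> (turyn_hadamard n H \<and> dephased n H)"
    and "diagonalisable_by G H"
    and "\<forall>j<n. laplacian G *\<^sub>v col H j = ev j \<cdot>\<^sub>v col H j"
  shows "\<exists>d :: nat.
      (\<forall>v\<in>pverts G. out_degree (with_proj G) v = d) \<and>
      (\<forall>k. 0 < k \<and> k < n \<longrightarrow>
        (\<exists>V1 V2.
          equitable_partition G [V1, V2] \<and>
          real (card V1) = real n / 2 \<and> real (card V2) = real n / 2 \<and>
          quotient_matrix G [V1, V2] =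
            mat_of_rows_list 2
              [[of_nat d - ev k / 2, ev k / 2],
               [ev k / 2, of_nat d - ev k / 2]])) \<and>
      (\<forall>\<mu>. eigenvalue (laplacian G) \<mu> \<longrightarrow> (\<exists>z :: int. even z \<and> \<mu> = of_int z))"
proof -
  note G = assms(1) and V = assms(2)
  have turyn: "turyn_hadamard n H" and deph: "dephased n H"
    using assms(3) real_hadamard_imp_turyn by auto
  then have cH: "complex_hadamard n H" and Hc: "H \<in> carrier_mat n n"
    by (auto simp: turyn_hadamard_def complex_hadamard_def)
  have ev: "\<And>k. k < n \<Longrightarrow> laplacian G *\<^sub>v col H k = ev k \<cdot>\<^sub>v col H k"
    using assms(5) by blast
  note L = laplacian_carrier[OF V]
  note herm = laplacian_hermitian[OF G V]
  have eigvec: "eigenvector (laplacian G) (col H k) (ev k)" if "k < n" for k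
  proof -
    have "col H k $ 0 = 1"
      using that deph Hc by (simp add: dephased_def)
    then have "col H k \<noteq> 0\<^sub>v n"
      using that by auto
    then show ?thesis
      using ev[OF that] L Hc that by (auto simp: eigenvector_def)
  qed
  \<comment> \<open>Vertex \<open>0\<close> is the reference for regularity. If
    \<open>n = 0\<close>, the value of \<open>d\<close> does not matter, as there are neither
    vertices nor columns.\<close>
  define d where "d = out_degree (with_proj G) 0"
  have reg: "out_degree (with_proj G) v = d" if "v \<in> pverts G" for v
  proof -
    have "v < n" "0 < n"
      using that V by auto
    then have "of_nat n * of_nat (out_degree (with_proj G) v) = (of_nat n * of_nat d :: complex)"
      unfolding d_def using laplacian_hadamard_trace[OF cH V G ev] by simp
    then show ?thesis
      using \<open>0 < n\<close> by simp
  qed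
  \<comment> \<open>The partition and the evenness of \<open>ev k\<close> are proved together, since
    both come from the same neighbour counts.\<close>
  have cell: "\<exists>V1 V2 m. equitable_partition G [V1, V2] \<and>
      real (card V1) = real n / 2 \<and> real (card V2) = real n / 2 \<and>
      quotient_matrix G [V1, V2] = mat_of_rows_list 2
        [[of_nat d - ev k / 2, ev k / 2], [ev k / 2, of_nat d - ev k / 2]] \<and>
      ev k = of_nat (2 * m)" if k: "0 < k" "k < n" for k
  proof -
    define r where "r = Re (ev k)"
    have evr: "ev k = of_real r"
      unfolding r_def using hermitian_eigenvalue_real[OF L herm eigvec[OF k(2)]]
      by (simp add: complex_eq_iff)
    have ne: "pverts G \<noteq> {}" using V k by simp
    have deg: "card {w. (u, w) \<in> parcs G} = d" if "u \<in> pverts G" for u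
      using reg[OF that] by (simp add: out_degree_with_proj)
    note sv = turyn_column_sign_vector[OF G V turyn deph reg ev[OF k(2), unfolded evr] k]
    obtain V1 V2 m where *: "equitable_partition G [V1, V2]"
      "real (card V1) = real (card (pverts G)) / 2" "real (card V2) = real (card (pverts G)) / 2"
      "quotient_matrix G [V1, V2] = mat_of_rows_list 2
        [[of_nat d - of_real r / 2, of_real r / 2], [of_real r / 2, of_nat d - of_real r / 2]]"
      "r = 2 * real m"
      using sign_eigenvector_equitable_partition[OF G ne sv(1,2) deg sv(3)] by blast
    have "ev k = of_nat (2 * m)"
      by (simp add: evr *(5))
    with * V show ?thesis
      unfolding evr by auto
  qed
  \<comment> \<open>The all-ones column gives no bipartition, so its eigenvalue is found separately:
    at vertex \<open>0\<close> the degree and the number of neighbours cancel.\<close>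
  have ev0: "ev 0 = 0" if n: "0 < n"
  proof -
    interpret pair_graph G by fact
    have "(\<Sum>j | (0, j) \<in> parcs G. col H 0 $ j) = (\<Sum>j | (0, j) \<in> parcs G. 1)"
      using Hc V n deph by (intro sum.cong refl) (auto simp: dephased_def dest!: in_arcsD2)
    then show ?thesis
      using laplacian_mult_vec_index[OF G V _ n, of "col H 0"] ev[OF n] Hc n deph
      by (simp add: dephased_def out_degree_with_proj)
  qed
  have even_ev: "\<exists>z::int. even z \<and> ev k = of_int z" if k: "k < n" for k
  proof (cases "k = 0")
    case True
    then show ?thesis
      using ev0 k by (intro exI[of _ 0]) simp
  next
    case False
    then have "0 < k"
      by simp
    then obtain m where "ev k = of_nat (2 * m)"
      using cell[OF _ k] by blast
    then show ?thesis
      by (intro exI[of _ "int (2 * m)"]) simp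
  qed
  have even_eigenvalue: "\<exists>z::int. even z \<and> \<mu> = of_int z" if \<mu>: "eigenvalue (laplacian G) \<mu>" for \<mu>
  proof -
    obtain v where v: "eigenvector (laplacian G) v \<mu>"
      using \<mu> by (auto simp: eigenvalue_def)
    then have vc: "v \<in> carrier_vec n" and v0: "v \<noteq> 0\<^sub>v n"
      using L by (auto simp: eigenvector_def)
    \<comment> \<open>An eigenvector for \<open>\<mu>\<close> is not orthogonal to all columns. A
      column with nonzero product must have the same eigenvalue, because eigenvectors of a Hermitian
      matrix for different eigenvalues are orthogonal.\<close>
    obtain k where k: "k < n" "v \<bullet>c col H k \<noteq> 0"
      using complex_hadamard_orthogonal_all[OF cH vc] v0 by blast
    have "\<mu> = cnj (ev k)"
      using hermitian_eigenvectors_cscalar_prod[OF L herm v eigvec[OF k(1)]] k(2) by simp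
    also have "\<dots> = ev k"
      using hermitian_eigenvalue_real[OF L herm eigvec[OF k(1)]] .
    finally show ?thesis
      using even_ev[OF k(1)] by simp
  qed
  show ?thesis
  proof (rule exI[of _ d], intro conjI ballI allI impI)
    fix k assume "0 < k \<and> k < n"
    then have "0 < k" "k < n"
      by simp_all
    from cell[OF this] show "\<exists>V1 V2. equitable_partition G [V1, V2] \<and>
        real (card V1) = real n / 2 \<and> real (card V2) = real n / 2 \<and>
        quotient_matrix G [V1, V2] = mat_of_rows_list 2
          [[of_nat d - ev k / 2, ev k / 2], [ev k / 2, of_nat d - ev k / 2]]"
      by blast
  qed (fact reg even_eigenvalue)+
qed

end
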